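(* Suppose Assumptions 1 and 2 (listed in the context) hold and $\overline{\epsilon}<\frac{m}{L}$. Let $\{x^k\}$ be a sequence generated by the VBPG method. Then: (i) the sequence $\{F(x^k)\}$ is strictly decreasing (unless $x^k\in\bar{\mathbf{X}}_P$ for some $k$); (ii) $\{x^k\}$ is bounded, and any cluster point $\bar{x}$ of $\{x^k\}$ is a limiting critical point of $F$, i.e. $0\in\partial_L F(\bar{x})$; furthermore, $\bar{x}$ is a proximal critical point of $F$, i.e. $0\in\partial_P F(\bar{x})$; (iii) if $\Omega$ denotes the set of accumulation points of $\{x^k\}$, then $F_\zeta:=\lim_{k\to+\infty}F(x^k)$ exists and $F(\bar{x})\le F_\zeta$ for every $\bar{x}\in\Omega$.
   Context: $\langle\cdot,\cdot\rangle,\|\cdot\|$ are the Euclidean inner product and norm on $\mathbb{R}^n$. $F=f+g$. Assumption 1: (i) $f:\mathbb{R}^n\to(-\infty,\infty]$ is proper lower semicontinuous (l.s.c.), differentiable on $\mathrm{dom} f$, $\mathrm{dom} f$ is convex, and $\nabla f$ is $L$-Lipschitz ($L>0$); (ii) $g:\mathbb{R}^n\to(-\infty,\infty]$ is proper l.s.c. and $\mathrm{dom}\,g$ is convex; (iii) $F$ is level-bounded: $\{x: F(x)\le r\}$ is bounded (possibly empty) for every $r\in\mathbb{R}$. Assumption 2: for each $k\in\mathbb{N}$, $K^k:\mathbb{R}^n\to\mathbb{R}$ is differentiable, strongly convex with uniform modulus $m>0$, and $\nabla K^k$ is uniformly $M$-Lipschitz; $0<\underline{\epsilon}\le\epsilon^k\le\overline{\epsilon}$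 for all $k$. Bregman distances: $D^k(x,y)=K^k(y)-[K^k(x)+\langle\nabla K^k(x),y-x\rangle]$. VBPG method (variable Bregman proximal gradient): from an initial point $x^0$, for all $k\ge0$, $x^{k+1}\in\operatorname{argmin}_{x\in\mathbb{R}^n}\{\langle\nabla f(x^k),x-x^k\rangle+g(x)+\frac{1}{\epsilon^k}D^k(x^k,x)\}$. ($f$ is understood to be finite and differentiable where $\nabla f$ is used.) Subdifferentials at $\bar x\in\mathrm{dom}\,\psi$: $\partial_P\psi(\bar x)$ (proximal) is the set of $\xi$ for which there are $\rho>0,\eta>0$ with $\psi(x)\ge\psi(\bar x)+\langle\xi,x-\bar x\rangle-\rho\|x-\bar x\|^2$ whenever $\|x-\bar x\|<\eta$; $\partial_F\psi(\bar x)$ (Fréchet) is the set of $\xi$ with $\liminf_{x\to\bar x,x\ne\bar x}\|x-\bar x\|^{-1}[\psi(x)-\psi(\bar x)-\langle\xi,x-\bar x\rangle]\ge0$; $\partial_L\psi(\bar x)$ (limiting) is the set of $\xi$ such that there are $x_n\to\bar x$ with $\psi(x_n)\to\psi(\bar x)$ and $\xi_n\in\partial_F\psi(x_n)$ with $\xi_n\to\xi$. $\bar{\mathbf{X}}_P=\{x:0\in\partial_PF(x)\}$ is the set of proximal critical points. *)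

theory Defs
  imports "HOL-Analysis.Analysis"
begin

(* Functions R^n -> (-oo, oo] are ereal-valued; the value -oo is excluded by proper_fun. *)

definition effective_domain :: "('a \<Rightarrow> ereal) \<Rightarrow> 'a set" where
  "effective_domain \<psi> = {x. \<psi> x < \<infinity>}"

definition proper_fun :: "('a \<Rightarrow> ereal) \<Rightarrow> bool" where
  "proper_fun \<psi> \<longleftrightarrow> (\<forall>x. \<psi> x \<noteq> -\<infinity>) \<and> (\<exists>x. \<psi> x \<noteq> \<infinity>)"

definition lsc :: "('a::topological_space \<Rightarrow> ereal) \<Rightarrow> bool" where
  "lsc \<psi> \<longleftrightarrow> (\<forall>x. \<psi> x \<le> Liminf (at x) \<psi>)"

definition level_bounded :: "('a::metric_space \<Rightarrow> ereal) \<Rightarrow> bool" where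
  "level_bounded \<psi> \<longleftrightarrow> (\<forall>r::real. bounded {x. \<psi> x \<le> ereal r})"

(* Differentiability is taken relative to the effective domain, which need not be open;
   df is the gradient map. It is determined by f at interior points of the domain;
   elsewhere it may be any map satisfying the condition. *)
definition has_gradient_on_dom :: "('a::real_inner \<Rightarrow> ereal) \<Rightarrow> ('a \<Rightarrow> 'a) \<Rightarrow> bool" where
  "has_gradient_on_dom f df \<longleftrightarrow>
     (\<forall>x\<in>effective_domain f.
        ((\<lambda>y. real_of_ereal (f y)) has_derivative (\<lambda>h. df x \<bullet> h)) (at x within effective_domain f))"

definition strongly_convex :: "real \<Rightarrow> ('a::real_normed_vector \<Rightarrow> real) \<Rightarrow> bool" where
  "strongly_convex m K \<longleftrightarrow>
     (\<forall>x y. \<forall>t\<in>{0..1}.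
        K ((1 - t) *\<^sub>R x + t *\<^sub>R y)
          \<le> (1 - t) * K x + t * K y - m / 2 * t * (1 - t) * (norm (x - y))\<^sup>2)"

(* dK is the gradient map of K. *)
definition bregman :: "('a::real_inner \<Rightarrow> real) \<Rightarrow> ('a \<Rightarrow> 'a) \<Rightarrow> 'a \<Rightarrow> 'a \<Rightarrow> real" where
  "bregman K dK x y = K y - (K x + dK x \<bullet> (y - x))"

(* The iterates are required to lie in dom f, since the k-th step uses the gradient of f at x k. *)
definition vbpg ::
  "('a::real_inner \<Rightarrow> ereal) \<Rightarrow> ('a \<Rightarrow> 'a) \<Rightarrow> ('a \<Rightarrow> ereal) \<Rightarrow> (nat \<Rightarrow> 'a \<Rightarrow> real) \<Rightarrow>
   (nat \<Rightarrow> 'a \<Rightarrow> 'a) \<Rightarrow> (nat \<Rightarrow> real) \<Rightarrow> (nat \<Rightarrow> 'a) \<Rightarrow> bool" where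
  "vbpg f df g K dK \<epsilon> x \<longleftrightarrow>
     (\<forall>k. x k \<in> effective_domain f \<and>
        is_arg_min
          (\<lambda>y. ereal (df (x k) \<bullet> (y - x k)) + g y + ereal (1 / \<epsilon> k * bregman (K k) (dK k) (x k) y))
          (\<lambda>y. True) (x (Suc k)))"

definition proximal_subdiff :: "('a::real_inner \<Rightarrow> ereal) \<Rightarrow> 'a \<Rightarrow> 'a set" where
  "proximal_subdiff \<psi> z =
     {\<xi>. z \<in> effective_domain \<psi> \<and>
        (\<exists>\<rho>>0. \<exists>\<eta>>0. \<forall>x. norm (x - z) < \<eta> \<longrightarrow>
           \<psi> z + ereal (\<xi> \<bullet> (x - z)) - ereal (\<rho> * (norm (x - z))\<^sup>2) \<le> \<psi> x)}"

definition frechet_subdiff :: "('a::real_inner \<Rightarrow> ereal) \<Rightarrow> 'a \<Rightarrow> 'a set" where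
  "frechet_subdiff \<psi> z =
     {\<xi>. z \<in> effective_domain \<psi> \<and>
        0 \<le> Liminf (at z) (\<lambda>x. (\<psi> x - \<psi> z - ereal (\<xi> \<bullet> (x - z))) / ereal (norm (x - z)))}"

definition limiting_subdiff :: "('a::real_inner \<Rightarrow> ereal) \<Rightarrow> 'a \<Rightarrow> 'a set" where
  "limiting_subdiff \<psi> z =
     {\<xi>. z \<in> effective_domain \<psi> \<and>
        (\<exists>u v. u \<longlonglongrightarrow> z \<and> (\<lambda>n. \<psi> (u n)) \<longlonglongrightarrow> \<psi> z \<and>
           (\<forall>n::nat. v n \<in> frechet_subdiff \<psi> (u n)) \<and> v \<longlonglongrightarrow> \<xi>)}"

definition proximal_critical :: "('a::real_inner \<Rightarrow> ereal) \<Rightarrow> 'a set" where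
  "proximal_critical \<psi> = {x. 0 \<in> proximal_subdiff \<psi> x}"

definition limiting_critical :: "('a::real_inner \<Rightarrow> ereal) \<Rightarrow> 'a set" where
  "limiting_critical \<psi> = {x. 0 \<in> limiting_subdiff \<psi> x}"

definition cluster_points :: "(nat \<Rightarrow> 'a::topological_space) \<Rightarrow> 'a set" where
  "cluster_points x = {l. \<exists>r::nat \<Rightarrow> nat. strict_mono r \<and> (x \<circ> r) \<longlonglongrightarrow> l}"

end

theory Submission
  imports Defs
begin

text \<open>The descent lemma for f and the minimality of each iterate give
  F(x(k+1)) + c |x(k+1) - x(k)|^2 \<le> F(x(k)) with c = (m/\<epsilon>_hi - L)/2 > 0, so values decrease and
  steps tend to zero. Minimality also bounds g from below by a quadratic model around x(k+1)
  whose curvature M/(2 \<epsilon>_lo) does not depend on k. It therefore passes to a cluster point z by lower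
  semicontinuity of g alone, and adding the quadratic lower bound on f shows that z is
  proximal critical; it is then limiting critical via constant sequences. The same estimate shows
  that a vanishing step occurs only at a proximal critical point.\<close>

section \<open>Quadratic bounds on first-order remainders\<close>

text \<open>The mean value theorem on the segment from \<open>x\<close> to \<open>y\<close>, with
  Cauchy-Schwarz and the Lipschitz bound, shows that the remainder minus its quadratic model does
  not increase. Derivatives are taken within \<open>S\<close> because the effective domain of
  \<open>f\<close> need not be open.\<close>

lemma descent_lemma:
  fixes \<phi> :: "'a::real_inner \<Rightarrow> real"
  assumes S: "convex S" "x \<in> S" "y \<in> S"
    and deriv: "\<And>z. z \<in> S \<Longrightarrow> (\<phi> has_derivative (\<lambda>h. d\<phi> z \<bullet> h)) (at z within S)"
    and lip: "L-lipschitz_on S d\<phi>"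
  shows "\<phi> y - \<phi> x - d\<phi> x \<bullet> (y - x) \<le> L / 2 * (norm (y - x))\<^sup>2"
proof -
  define p where "p t = x + t *\<^sub>R (y - x)" for t
  \<comment> \<open>The claim is exactly \<open>q 1 \<le> q 0\<close>, and \<open>q'\<close> is the
    derivative of \<open>q\<close>.\<close>
  define q where "q t = \<phi> (p t) - t * (d\<phi> x \<bullet> (y - x)) - L / 2 * t\<^sup>2 * (norm (y - x))\<^sup>2" for t
  define q' where "q' t = d\<phi> (p t) \<bullet> (y - x) - d\<phi> x \<bullet> (y - x) - L * t * (norm (y - x))\<^sup>2" for t
  have pS: "p t \<in> S" if "t \<in> {0..1}" for t
  proof -
    have "p t = (1 - t) *\<^sub>R x + t *\<^sub>R y"
      by (simp add: p_def algebra_simps)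
    then show ?thesis
      using that S by (simp add: convexD_alt)
  qed
  have dq: "(q has_derivative (\<lambda>h. h * q' t)) (at t within {0..1})" if "t \<in> {0..1}" for t
  proof -
    have "(p has_derivative (\<lambda>h. h *\<^sub>R (y - x))) (at t within {0..1})"
      unfolding p_def by (auto intro!: derivative_eq_intros)
    \<comment> \<open>The chain rule needs the derivative only within the image of the segment,
      which lies in \<open>S\<close> by convexity.\<close>
    moreover have "(\<phi> has_derivative (\<lambda>h. d\<phi> (p t) \<bullet> h)) (at (p t) within p ` {0..1})"
      using deriv[OF pS[OF that]] by (rule has_derivative_subset) (use pS in auto)
    ultimately have "((\<lambda>t. \<phi> (p t)) has_derivative (\<lambda>h. d\<phi> (p t) \<bullet> (h *\<^sub>R (y - x))))
        (at t within {0..1})"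
      using has_derivative_in_compose by blast
    then show ?thesis
      unfolding q_def
      by (auto intro!: derivative_eq_intros simp: q'_def algebra_simps)
  qed
  obtain t where t: "t \<in> {0<..<1}" "q 1 - q 0 = (1 - 0) * q' t"
    using mvt_simple[of 0 1 q "\<lambda>t h. h * q' t"] dq by auto
  have "(d\<phi> (p t) - d\<phi> x) \<bullet> (y - x) \<le> norm (d\<phi> (p t) - d\<phi> x) * norm (y - x)"
    by (rule norm_cauchy_schwarz)
  also have "\<dots> \<le> (L * norm (p t - x)) * norm (y - x)"
    using lipschitz_onD[OF lip pS S(2), of t] t by (intro mult_right_mono) (auto simp: dist_norm)
  also have "\<dots> = L * t * (norm (y - x))\<^sup>2"
    using t by (simp add: p_def power2_eq_square)
  finally have "q' t \<le> 0"
    by (simp add: q'_def inner_diff_left)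
  then show ?thesis
    using t by (simp add: q_def p_def)
qed

text \<open>The one-sided bound is applied to \<open>\<phi>\<close> and to its negative. For
  \<open>f\<close>, the upper half yields the decrease of the values and the lower half yields
  proximal criticality.\<close>

lemma descent_lemma_abs:
  fixes \<phi> :: "'a::real_inner \<Rightarrow> real"
  assumes "convex S" "x \<in> S" "y \<in> S"
    and deriv: "\<And>z. z \<in> S \<Longrightarrow> (\<phi> has_derivative (\<lambda>h. d\<phi> z \<bullet> h)) (at z within S)"
    and lip: "L-lipschitz_on S d\<phi>"
  shows "\<bar>\<phi> y - \<phi> x - d\<phi> x \<bullet> (y - x)\<bar> \<le> L / 2 * (norm (y - x))\<^sup>2"
proof -
  have "((\<lambda>z. - \<phi> z) has_derivative (\<lambda>h. (- d\<phi> z) \<bullet> h)) (at z within S)" if "z \<in> S" for z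
    using has_derivative_minus[OF deriv[OF that]] by simp
  moreover have "L-lipschitz_on S (\<lambda>z. - d\<phi> z)"
    using lip by (simp add: lipschitz_on_def dist_minus)
  ultimately show ?thesis
    using descent_lemma[OF assms] descent_lemma[OF assms(1-3), of "\<lambda>z. - \<phi> z" "\<lambda>z. - d\<phi> z" L]
    by (auto simp: abs_if)
qed

text \<open>Dividing the strong convexity inequality by \<open>t\<close> bounds the difference
  quotient of \<open>K\<close> along the segment; letting \<open>t\<close> tend to 0 from the right
  turns the quotient into the directional derivative.\<close>

lemma bregman_lower_bound:
  fixes K :: "'a::real_inner \<Rightarrow> real"
  assumes "GDERIV K x :> dK x" and sc: "strongly_convex m K"
  shows "m / 2 * (norm (y - x))\<^sup>2 \<le> bregman K dK x y"
proof -
  define p where "p t = x + t *\<^sub>R (y - x)" for t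
  have "(p has_derivative (\<lambda>h. h *\<^sub>R (y - x))) (at 0)"
    unfolding p_def by (auto intro!: derivative_eq_intros)
  moreover have "(K has_derivative (\<lambda>h. h \<bullet> dK x)) (at (p 0))"
    using assms(1) by (simp add: gderiv_def p_def)
  ultimately have "((\<lambda>t. K (p t)) has_derivative (\<lambda>h. (h *\<^sub>R (y - x)) \<bullet> dK x)) (at 0)"
    by (rule has_derivative_compose)
  then have "((\<lambda>t. K (p t)) has_real_derivative dK x \<bullet> (y - x)) (at 0)"
    by (simp add: has_field_derivative_def inner_commute mult.commute[of _ "_ \<bullet> _"] mult_commute_abs)
  then have "((\<lambda>t. (K (p t) - K x) / t) \<longlongrightarrow> dK x \<bullet> (y - x)) (at 0)"
    by (simp add: DERIV_def p_def)
  then have lim: "((\<lambda>t. (K (p t) - K x) / t) \<longlongrightarrow> dK x \<bullet> (y - x)) (at_right 0)"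
    by (rule filterlim_mono) (auto simp: at_le)
  have lim2: "((\<lambda>t. K y - K x - m / 2 * (1 - t) * (norm (y - x))\<^sup>2)
      \<longlongrightarrow> K y - K x - m / 2 * (1 - 0) * (norm (y - x))\<^sup>2) (at_right 0)"
    by (intro tendsto_intros)
  have "eventually (\<lambda>t. t \<in> {0<..<1::real}) (at_right 0)"
    by (rule eventually_at_right_real) simp
  then have "eventually (\<lambda>t. (K (p t) - K x) / t \<le> K y - K x - m / 2 * (1 - t) * (norm (y - x))\<^sup>2)
      (at_right 0)"
  proof (rule eventually_mono)
    fix t :: real assume t: "t \<in> {0<..<1}"
    have "K ((1 - t) *\<^sub>R x + t *\<^sub>R y)
          \<le> (1 - t) * K x + t * K y - m / 2 * t * (1 - t) * (norm (x - y))\<^sup>2"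
      using sc t by (auto simp: strongly_convex_def)
    moreover have "(1 - t) *\<^sub>R x + t *\<^sub>R y = p t"
      by (simp add: p_def algebra_simps)
    ultimately have "K (p t) - K x \<le> (K y - K x - m / 2 * (1 - t) * (norm (y - x))\<^sup>2) * t"
      by (simp add: norm_minus_commute algebra_simps)
    then show "(K (p t) - K x) / t \<le> K y - K x - m / 2 * (1 - t) * (norm (y - x))\<^sup>2"
      using t by (simp add: pos_divide_le_eq)
  qed
  with lim lim2 have "dK x \<bullet> (y - x) \<le> K y - K x - m / 2 * (1 - 0) * (norm (y - x))\<^sup>2"
    by (intro tendsto_le[OF _ lim2 lim]) auto
  then show ?thesis
    by (simp add: bregman_def)
qed

lemma bregman_upper_bound:
  fixes K :: "'a::real_inner \<Rightarrow> real"
  assumes "\<And>z. GDERIV K z :> dK z" and "M-lipschitz_on UNIV dK"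
  shows "bregman K dK x y \<le> M / 2 * (norm (y - x))\<^sup>2"
proof -
  have "(K has_derivative (\<lambda>h. dK z \<bullet> h)) (at z)" for z
    using assms(1)[of z] by (simp add: gderiv_def inner_commute)
  then show ?thesis
    using descent_lemma[of UNIV x y K dK M] assms(2) by (simp add: bregman_def)
qed

section \<open>Lower semicontinuity along filters and under sums\<close>

lemma lsc_eventually_less:
  assumes "lsc \<psi>" "(u \<longlongrightarrow> z) A" "c < \<psi> z"
  shows "eventually (\<lambda>n. c < \<psi> (u n)) A"
proof -
  have "c < Liminf (at z) \<psi>"
    using assms(1,3) by (auto simp: lsc_def intro: less_le_trans)
  then have "eventually (\<lambda>y. c < \<psi> y) (at z)"
    using le_Liminf_iff[of "Liminf (at z) \<psi>" "at z" \<psi>] by blast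
  \<comment> \<open>\<open>Liminf (at z)\<close> ignores the point \<open>z\<close> itself; the
    assumption \<open>c < \<psi> z\<close> fills this gap, so \<open>u\<close> may take the value
    \<open>z\<close>.\<close>
  then have "eventually (\<lambda>y. c < \<psi> y) (nhds z)"
    using assms(3) by (simp add: eventually_nhds_conv_at)
  then show ?thesis
    using assms(2) by (rule eventually_compose_filterlim)
qed

text \<open>A level strictly between \<open>B\<close> and \<open>\<psi> z\<close> would eventually
  separate \<open>\<psi> (u n)\<close> from its upper bound \<open>b n\<close>. This form serves
  both for \<open>F\<close> below the limit of its values and for passing the minimality inequality
  for \<open>g\<close> to the limit.\<close>

lemma lsc_le_lim:
  assumes "lsc \<psi>" "(u \<longlongrightarrow> z) A" "A \<noteq> bot"
    and le: "eventually (\<lambda>n. \<psi> (u n) \<le> b n) A" and lim: "(b \<longlongrightarrow> B) A"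
  shows "\<psi> z \<le> B"
proof (rule ccontr)
  assume "\<not> \<psi> z \<le> B"
  then obtain c where c: "B < c" "c < \<psi> z"
    using dense[of B "\<psi> z"] by (auto simp: not_le)
  have "eventually (\<lambda>n. c < \<psi> (u n) \<and> \<psi> (u n) \<le> b n \<and> b n < c) A"
    using lsc_eventually_less[OF assms(1,2) c(2)] le order_tendstoD(2)[OF lim c(1)]
    by eventually_elim auto
  then have "eventually (\<lambda>n. False) A"
    by (rule eventually_mono) auto
  then show False
    using assms(3) by simp
qed

lemma lsc_add:
  fixes f g :: "'a::topological_space \<Rightarrow> ereal"
  assumes "lsc f" "lsc g" "\<And>x. f x \<noteq> -\<infinity>" "\<And>x. g x \<noteq> -\<infinity>"
  shows "lsc (\<lambda>x. f x + g x)"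
  unfolding lsc_def
proof
  fix x
  show "f x + g x \<le> Liminf (at x) (\<lambda>x. f x + g x)"
  proof (cases "at x = bot")
    case False
    \<comment> \<open>Truncating at \<open>h x\<close> turns lower semicontinuity into a genuine
      limit, also when \<open>h x\<close> is infinite. Limits can then be added, since neither is
      minus infinity.\<close>
    have min: "((\<lambda>y. min (h x) (h y)) \<longlongrightarrow> h x) (at x)" if "lsc h" for h :: "'a \<Rightarrow> ereal"
    proof (rule order_tendstoI)
      fix a assume "a < h x"
      then show "\<forall>\<^sub>F y in at x. a < min (h x) (h y)"
        using lsc_eventually_less[OF that tendsto_ident_at] by simp
    qed (simp add: min_less_iff_disj)
    have "((\<lambda>y. min (f x) (f y) + min (g x) (g y)) \<longlongrightarrow> f x + g x) (at x)"
      using assms by (intro tendsto_add_ereal_general min) auto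
    then have "f x + g x = Liminf (at x) (\<lambda>y. min (f x) (f y) + min (g x) (g y))"
      using False by (intro lim_imp_Liminf[symmetric])
    also have "\<dots> \<le> Liminf (at x) (\<lambda>y. f y + g y)"
      by (intro Liminf_mono always_eventually allI add_mono) auto
    finally show ?thesis .
  qed simp
qed

section \<open>Relations between subdifferentials and a criterion for criticality\<close>

text \<open>Divided by the norm, the quadratic error of the proximal inequality becomes
  \<open>- \<rho> * norm (x - z)\<close>, which tends to 0. The class \<open>perfect_space\<close>
  makes \<open>at z\<close> nontrivial, so this limit is a \<open>Liminf\<close>.\<close>

lemma proximal_subset_frechet:
  fixes \<psi> :: "'a::{real_inner,perfect_space} \<Rightarrow> ereal"
  assumes "\<psi> z \<noteq> -\<infinity>"
  shows "proximal_subdiff \<psi> z \<subseteq> frechet_subdiff \<psi> z"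
proof
  fix \<xi> assume "\<xi> \<in> proximal_subdiff \<psi> z"
  then obtain \<rho> \<eta> where dom: "\<psi> z < \<infinity>" and "\<eta> > 0"
    and le: "\<And>x. norm (x - z) < \<eta> \<Longrightarrow>
      \<psi> z + ereal (\<xi> \<bullet> (x - z)) - ereal (\<rho> * (norm (x - z))\<^sup>2) \<le> \<psi> x"
    by (auto simp: proximal_subdiff_def effective_domain_def)
  obtain r where r: "\<psi> z = ereal r"
    using assms dom by (cases "\<psi> z") auto
  have "((\<lambda>x. - \<rho> * norm (x - z)) \<longlongrightarrow> - \<rho> * norm (z - z)) (at z)"
    by (intro tendsto_intros)
  then have "Liminf (at z) (\<lambda>x. ereal (- \<rho> * norm (x - z))) = ereal (- \<rho> * norm (z - z))"
    by (intro lim_imp_Liminf) (auto intro: tendsto_ereal)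
  then have "0 = Liminf (at z) (\<lambda>x. ereal (- \<rho> * norm (x - z)))"
    by (simp add: zero_ereal_def)
  also have "\<dots> \<le> Liminf (at z) (\<lambda>x. (\<psi> x - \<psi> z - ereal (\<xi> \<bullet> (x - z))) / ereal (norm (x - z)))"
  proof (rule Liminf_mono)
    show "\<forall>\<^sub>F x in at z. ereal (- \<rho> * norm (x - z))
        \<le> (\<psi> x - \<psi> z - ereal (\<xi> \<bullet> (x - z))) / ereal (norm (x - z))"
      unfolding eventually_at
    proof (intro exI[of _ \<eta>] conjI ballI impI \<open>\<eta> > 0\<close>)
      fix x assume x: "x \<noteq> z \<and> dist x z < \<eta>"
      then have "ereal (r + \<xi> \<bullet> (x - z) - \<rho> * (norm (x - z))\<^sup>2) \<le> \<psi> x"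
        using le[of x] by (simp add: dist_norm r)
      then show "ereal (- \<rho> * norm (x - z))
          \<le> (\<psi> x - \<psi> z - ereal (\<xi> \<bullet> (x - z))) / ereal (norm (x - z))"
        using x by (cases "\<psi> x") (auto simp: r field_simps power2_eq_square)
    qed
  qed
  finally show "\<xi> \<in> frechet_subdiff \<psi> z"
    using dom by (simp add: frechet_subdiff_def effective_domain_def)
qed

lemma frechet_subset_limiting: "frechet_subdiff \<psi> z \<subseteq> limiting_subdiff \<psi> z"
proof
  fix \<xi> assume \<xi>: "\<xi> \<in> frechet_subdiff \<psi> z"
  then show "\<xi> \<in> limiting_subdiff \<psi> z"
    unfolding limiting_subdiff_def mem_Collect_eq
    by (intro conjI exI[of _ "\<lambda>_. z"] exI[of _ "\<lambda>_. \<xi>"]) (auto simp: frechet_subdiff_def)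
qed

lemma proximal_critical_imp_limiting_critical:
  fixes \<psi> :: "'a::{real_inner,perfect_space} \<Rightarrow> ereal"
  assumes "\<psi> z \<noteq> -\<infinity>" "z \<in> proximal_critical \<psi>"
  shows "z \<in> limiting_critical \<psi>"
  using assms proximal_subset_frechet[of \<psi> z] frechet_subset_limiting[of \<psi> z]
  by (auto simp: proximal_critical_def limiting_critical_def)

lemma descent_on_dom:
  fixes f :: "'a::real_inner \<Rightarrow> ereal"
  assumes "convex (effective_domain f)" "has_gradient_on_dom f df"
    "L-lipschitz_on (effective_domain f) df" "x \<in> effective_domain f" "y \<in> effective_domain f"
  shows "\<bar>real_of_ereal (f y) - real_of_ereal (f x) - df x \<bullet> (y - x)\<bar> \<le> L / 2 * (norm (y - x))\<^sup>2"
  using assms by (intro descent_lemma_abs[where S = "effective_domain f"])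
    (auto simp: has_gradient_on_dom_def)

text \<open>The last assumption is what minimality in the subproblem leaves once the step vanishes,
  exactly or in the limit. Adding the quadratic lower bound on \<open>f\<close> cancels the terms in
  \<open>df z\<close>.\<close>

lemma proximal_criticalI:
  fixes f g :: "'a::real_inner \<Rightarrow> ereal"
  assumes conv: "convex (effective_domain f)" and df: "has_gradient_on_dom f df"
    and lip: "L-lipschitz_on (effective_domain f) df"
    and f: "\<And>y. f y \<noteq> -\<infinity>" and g: "\<And>y. g y \<noteq> -\<infinity>"
    and z: "z \<in> effective_domain f" "z \<in> effective_domain g" and "0 \<le> C"
    and le: "\<And>y. g z \<le> g y + ereal (df z \<bullet> (y - z) + C * (norm (y - z))\<^sup>2)"
  shows "z \<in> proximal_critical (\<lambda>y. f y + g y)"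
proof -
  obtain a b where ab: "f z = ereal a" "g z = ereal b"
    using z f[of z] g[of z] by (cases "f z"; cases "g z") (auto simp: effective_domain_def)
  have "0 \<le> L"
    using lip by (rule lipschitz_on_nonneg)
  have *: "f z + g z - ereal ((L / 2 + C + 1) * (norm (y - z))\<^sup>2) \<le> f y + g y" for y
  proof (cases "f y = \<infinity> \<or> g y = \<infinity>")
    case True
    then show ?thesis
      using f[of y] g[of y] by (auto simp: plus_ereal.simps)
  next
    case False
    then obtain c d where cd: "f y = ereal c" "g y = ereal d"
      using f[of y] g[of y] by (cases "f y"; cases "g y") auto
    have "\<bar>c - a - df z \<bullet> (y - z)\<bar> \<le> L / 2 * (norm (y - z))\<^sup>2"
      using descent_on_dom[OF conv df lip z(1), of y] ab cd by (simp add: effective_domain_def)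
    moreover have "b \<le> d + (df z \<bullet> (y - z) + C * (norm (y - z))\<^sup>2)"
      using le[of y] ab cd by simp
    moreover have "(L / 2 + C + 1) * (norm (y - z))\<^sup>2
        = L / 2 * (norm (y - z))\<^sup>2 + C * (norm (y - z))\<^sup>2 + (norm (y - z))\<^sup>2"
      by (simp add: algebra_simps)
    moreover have "0 \<le> (norm (y - z))\<^sup>2"
      by simp
    ultimately have "a + b - (L / 2 + C + 1) * (norm (y - z))\<^sup>2 \<le> c + d"
      by linarith
    then show ?thesis
      using ab cd by simp
  qed
  \<comment> \<open>The summand 1 keeps the proximal constant positive even if \<open>L\<close> and
    \<open>C\<close> are 0. The radius 1 below is arbitrary because \<open>*\<close> holds for every
    \<open>y\<close>.\<close>
  have "L / 2 + C + 1 > 0"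
    using \<open>0 \<le> L\<close> \<open>0 \<le> C\<close> by simp
  then show ?thesis
    using * ab unfolding proximal_critical_def proximal_subdiff_def mem_Collect_eq
    by (intro conjI exI[of _ "L / 2 + C + 1"] exI[of _ "1::real"])
      (auto simp: effective_domain_def zero_ereal_def[symmetric])
qed

theorem proposition3p1:
  fixes f g F :: "real ^ 'n \<Rightarrow> ereal"
    and df :: "real ^ 'n \<Rightarrow> real ^ 'n"
    and K :: "nat \<Rightarrow> real ^ 'n \<Rightarrow> real"
    and dK :: "nat \<Rightarrow> real ^ 'n \<Rightarrow> real ^ 'n"
    and \<epsilon> :: "nat \<Rightarrow> real"
    and x :: "nat \<Rightarrow> real ^ 'n"
    and L m M \<epsilon>_lo \<epsilon>_hi :: real
  assumes F: "F = (\<lambda>z. f z + g z)"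
    and f: "proper_fun f" "lsc f" "convex (effective_domain f)"
    and df: "has_gradient_on_dom f df" "L-lipschitz_on (effective_domain f) df" "L > 0"
    and g: "proper_fun g" "lsc g" "convex (effective_domain g)"
    and level: "level_bounded F"
    and K: "\<And>k z. GDERIV (K k) z :> dK k z" "\<And>k. strongly_convex m (K k)"
      "\<And>k. M-lipschitz_on UNIV (dK k)" "m > 0"
    and eps: "0 < \<epsilon>_lo" "\<And>k. \<epsilon>_lo \<le> \<epsilon> k" "\<And>k. \<epsilon> k \<le> \<epsilon>_hi" "\<epsilon>_hi < m / L"
    and x: "vbpg f df g K dK \<epsilon> x"
  shows "((\<forall>k. x k \<notin> proximal_critical F) \<longrightarrow> strict_antimono_on UNIV (\<lambda>k. F (x k)))
    \<and> (bounded (range x) \<and>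
       (\<forall>z\<in>cluster_points x. z \<in> limiting_critical F \<and> z \<in> proximal_critical F))
    \<and> (\<exists>F\<^sub>\<zeta>::real. (\<lambda>k. F (x k)) \<longlonglongrightarrow> ereal F\<^sub>\<zeta> \<and> (\<forall>z\<in>cluster_points x. F z \<le> ereal F\<^sub>\<zeta>))"
proof -
  have f_ninf: "f y \<noteq> -\<infinity>" and g_ninf: "g y \<noteq> -\<infinity>" for y
    using f(1) g(1) by (auto simp: proper_fun_def)
  have lscF: "lsc F"
    unfolding F using f(2) g(2) f_ninf g_ninf by (rule lsc_add)
  have F_ninf: "F y \<noteq> -\<infinity>" for y
    using f_ninf[of y] g_ninf[of y] by (auto simp: F plus_ereal.simps)
  have eps_pos: "0 < \<epsilon> k" for k
    using eps(1) eps(2)[of k] by linarith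
  have "0 \<le> M"
    using K(3)[of 0] by (rule lipschitz_on_nonneg)
  \<comment> \<open>Chosen so that \<open>c + L / 2\<close> equals
    \<open>m / (2 * \<epsilon>_hi)\<close>, the curvature guaranteed for every scaled Bregman term;
    \<open>L / 2\<close> of it is spent on the remainder of \<open>f\<close>.\<close>
  define c where "c = (m / \<epsilon>_hi - L) / 2"
  define C where "C = M / (2 * \<epsilon>_lo)"
  have hi_pos: "0 < \<epsilon>_hi"
    using eps(3)[of 0] eps_pos[of 0] by linarith
  then have c_pos: "0 < c"
    using eps(4) df(3) by (simp add: c_def field_simps)
  have C_nonneg: "0 \<le> C"
    using \<open>0 \<le> M\<close> eps(1) by (simp add: C_def)

  \<comment> \<open>Bounds on the scaled Bregman terms, uniform in the iteration\<close>
  define B where "B k y = 1 / \<epsilon> k * bregman (K k) (dK k) (x k) y" for k y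
  have B_lower: "(c + L / 2) * (norm (y - x k))\<^sup>2 \<le> B k y" for k y
  proof -
    have "(c + L / 2) * (norm (y - x k))\<^sup>2 = 1 / \<epsilon>_hi * (m / 2 * (norm (y - x k))\<^sup>2)"
      by (simp add: c_def field_simps)
    also have "\<dots> \<le> 1 / \<epsilon> k * (m / 2 * (norm (y - x k))\<^sup>2)"
      using eps(3)[of k] eps_pos[of k] K(4) by (intro mult_right_mono divide_left_mono) auto
    also have "\<dots> \<le> B k y"
      unfolding B_def using eps_pos[of k] bregman_lower_bound[where K = "K k" and dK = "dK k", OF K(1,2)]
      by (intro mult_left_mono) (auto simp: less_imp_le)
    finally show ?thesis .
  qed
  have B_upper: "B k y \<le> C * (norm (y - x k))\<^sup>2" for k y
  proof -
    have "B k y \<le> 1 / \<epsilon> k * (M / 2 * (norm (y - x k))\<^sup>2)"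
      unfolding B_def using eps_pos[of k] bregman_upper_bound[where K = "K k" and dK = "dK k", OF K(1,3)]
      by (intro mult_left_mono) (auto simp: less_imp_le)
    also have "\<dots> \<le> 1 / \<epsilon>_lo * (M / 2 * (norm (y - x k))\<^sup>2)"
      using eps(1,2) eps_pos[of k] \<open>0 \<le> M\<close> by (intro mult_right_mono divide_left_mono) auto
    also have "\<dots> = C * (norm (y - x k))\<^sup>2"
      by (simp add: C_def)
    finally show ?thesis .
  qed

  \<comment> \<open>Consequences of the minimality of the iterates\<close>
  have x_dom_f: "x k \<in> effective_domain f" for k
    using x by (simp add: vbpg_def)
  have minimal: "ereal (df (x k) \<bullet> (x (Suc k) - x k)) + g (x (Suc k)) + ereal (B k (x (Suc k)))
      \<le> ereal (df (x k) \<bullet> (y - x k)) + g y + ereal (B k y)" for k y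
    using x unfolding vbpg_def is_arg_min_def B_def by (metis not_le)
  \<comment> \<open>Only successors are covered: \<open>x 0\<close> may lie outside the domain of
    \<open>g\<close>. Comparison with any point where \<open>g\<close> is finite suffices.\<close>
  have x_dom_g: "x (Suc k) \<in> effective_domain g" for k
  proof -
    obtain y where "g y \<noteq> \<infinity>"
      using g(1) by (auto simp: proper_fun_def)
    then show ?thesis
      using minimal[of k y] g_ninf[of y]
      by (cases "g y"; cases "g (x (Suc k))") (auto simp: effective_domain_def)
  qed
  define fr where "fr y = real_of_ereal (f y)" for y
  define gr where "gr y = real_of_ereal (g y)" for y
  have fr: "f y = ereal (fr y)" if "y \<in> effective_domain f" for y
    using that f_ninf[of y] by (cases "f y") (auto simp: effective_domain_def fr_def)
  have gr: "g y = ereal (gr y)" if "y \<in> effective_domain g" for y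
    using that g_ninf[of y] by (cases "g y") (auto simp: effective_domain_def gr_def)
  have minimal_gr: "df (x k) \<bullet> (x (Suc k) - x k) + gr (x (Suc k)) + B k (x (Suc k))
      \<le> df (x k) \<bullet> (y - x k) + gr y + B k y" if "y \<in> effective_domain g" for k y
    using minimal[of k y] gr[OF that] gr[OF x_dom_g[of k]] by simp

  have descent: "F (x (Suc k)) + ereal (c * (norm (x (Suc k) - x k))\<^sup>2) \<le> F (x k)" for k
  proof (cases "x k \<in> effective_domain g")
    case True
    \<comment> \<open>The competitor in the subproblem is \<open>x k\<close> itself.\<close>
    have "bregman (K k) (dK k) (x k) (x k) = 0"
      by (simp add: bregman_def)
    then have "df (x k) \<bullet> (x (Suc k) - x k) + gr (x (Suc k)) + B k (x (Suc k)) \<le> gr (x k)"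
      using minimal_gr[OF True, of k] by (simp add: B_def)
    moreover have "(c + L / 2) * (norm (x (Suc k) - x k))\<^sup>2 \<le> B k (x (Suc k))"
      by (rule B_lower)
    moreover have "\<bar>fr (x (Suc k)) - fr (x k) - df (x k) \<bullet> (x (Suc k) - x k)\<bar>
        \<le> L / 2 * (norm (x (Suc k) - x k))\<^sup>2"
      unfolding fr_def using f(3) df(1,2) x_dom_f x_dom_f by (rule descent_on_dom)
    ultimately have "fr (x (Suc k)) + gr (x (Suc k)) + c * (norm (x (Suc k) - x k))\<^sup>2
        \<le> fr (x k) + gr (x k)"
      unfolding distrib_right by linarith
    then show ?thesis
      using fr[OF x_dom_f] gr[OF True] gr[OF x_dom_g] by (simp add: F)
  next
    case False
    \<comment> \<open>This can occur only for \<open>k = 0\<close>, and then \<open>F (x k)\<close>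
      is infinite.\<close>
    then show ?thesis
      using f_ninf[of "x k"] by (simp add: F effective_domain_def)
  qed

  \<comment> \<open>The Bregman term at \<open>x (Suc k)\<close> is dropped as nonnegative and the
    one at \<open>y\<close> is replaced by its upper bound. The linear part is centred at
    \<open>x (Suc k)\<close>, the quadratic part at \<open>x k\<close>; the centres merge when the
    step vanishes.\<close>
  have near_minimal: "g (x (Suc k)) \<le> g y + ereal (df (x k) \<bullet> (y - x (Suc k)) + C * (norm (y - x k))\<^sup>2)"
    for k y
  proof (cases "y \<in> effective_domain g")
    case True
    have "0 \<le> (c + L / 2) * (norm (x (Suc k) - x k))\<^sup>2"
      using c_pos df(3) by simp
    then have "0 \<le> B k (x (Suc k))"
      using B_lower[where k = k] by (rule order_trans)
    then have "gr (x (Suc k)) \<le> gr y + (df (x k) \<bullet> (y - x (Suc k)) + C * (norm (y - x k))\<^sup>2)"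
      using minimal_gr[OF True, of k] B_upper[of k y] by (simp add: inner_diff_right)
    then show ?thesis
      using gr[OF True] gr[OF x_dom_g] by simp
  next
    case False
    then show ?thesis
      by (simp add: effective_domain_def)
  qed

  have fixed_critical: "x k \<in> proximal_critical F" if "x (Suc k) = x k" for k
    unfolding F using f(3) df(1,2) f_ninf g_ninf
  proof (rule proximal_criticalI[OF _ _ _ _ _ _ _ C_nonneg])
    show "g (x k) \<le> g y + ereal (df (x k) \<bullet> (y - x k) + C * (norm (y - x k))\<^sup>2)" for y
      using near_minimal[of k y] that by simp
  qed (use x_dom_f x_dom_g[of k] that in auto)

  \<comment> \<open>Monotonicity and convergence of the values, boundedness of the iterates\<close>
  \<comment> \<open>The shift by one makes the values real even if \<open>F (x 0)\<close> is
    infinite.\<close>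
  define Fr where "Fr k = fr (x (Suc k)) + gr (x (Suc k))" for k
  have Fr: "F (x (Suc k)) = ereal (Fr k)" for k
    using fr[OF x_dom_f] gr[OF x_dom_g] by (simp add: F Fr_def)
  have Fr_descent: "Fr (Suc k) + c * (norm (x (Suc (Suc k)) - x (Suc k)))\<^sup>2 \<le> Fr k" for k
    using descent[of "Suc k"] by (simp add: Fr)
  have "Fr (Suc k) \<le> Fr k" for k
    using Fr_descent[of k] c_pos by (smt (verit) mult_nonneg_nonneg zero_le_power2)
  then have decF: "decseq Fr"
    by (rule decseq_SucI)

  have strict: "strict_antimono_on UNIV (\<lambda>k. F (x k))" if nc: "\<forall>k. x k \<notin> proximal_critical F"
  proof -
    have step: "F (x (Suc k)) < F (x k)" for k
    proof -
      have "0 < c * (norm (x (Suc k) - x k))\<^sup>2"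
        using c_pos nc fixed_critical[of k] by (intro mult_pos_pos) auto
      \<comment> \<open>Strictness relies on \<open>F (x (Suc k))\<close> being finite, which
        \<open>Fr\<close> provides.\<close>
      then have "F (x (Suc k)) < F (x (Suc k)) + ereal (c * (norm (x (Suc k) - x k))\<^sup>2)"
        by (simp add: Fr)
      also have "\<dots> \<le> F (x k)"
        by (rule descent)
      finally show ?thesis .
    qed
    then have "F (x j) < F (x i)" if "i < j" for i j
      using that by (rule lift_Suc_mono_less[of "\<lambda>k. - F (x k)", simplified])
    then show ?thesis
      by (auto simp: monotone_on_def)
  qed

  have "x (Suc k) \<in> {y. F y \<le> ereal (Fr 0)}" for k
    using decF by (simp add: Fr decseq_def)
  then have "range (\<lambda>k. x (Suc k)) \<subseteq> {y. F y \<le> ereal (Fr 0)}"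
    by blast
  moreover have "bounded {y. F y \<le> ereal (Fr 0)}"
    using level by (simp add: level_bounded_def)
  ultimately have bdd_Suc: "bounded (range (\<lambda>k. x (Suc k)))"
    by (rule bounded_subset[rotated])
  \<comment> \<open>The initial point is added separately, since \<open>F (x 0)\<close> may exceed
    the level \<open>Fr 0\<close> or be infinite.\<close>
  have "range x \<subseteq> insert (x 0) (range (\<lambda>k. x (Suc k)))"
  proof
    fix y assume "y \<in> range x"
    then obtain k where "y = x k" by auto
    then show "y \<in> insert (x 0) (range (\<lambda>k. x (Suc k)))"
      by (cases k) auto
  qed
  then have bdd: "bounded (range x)"
    using bdd_Suc by (meson bounded_insert bounded_subset)

  \<comment> \<open>By boundedness and lower semicontinuity, the limit of the values dominates F at some cluster point,
    where F is not -\<infinity>.\<close>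
  have F_lim: "(\<lambda>k. F (x (Suc k))) \<longlonglongrightarrow> (INF k. ereal (Fr k))"
    using LIMSEQ_INF[of "\<lambda>k. ereal (Fr k)"] decF by (simp add: Fr decseq_def)
  obtain F\<zeta> where F\<zeta>: "(INF k. ereal (Fr k)) = ereal F\<zeta>"
  proof -
    obtain z r where "strict_mono r" "((\<lambda>k. x (Suc k)) \<circ> r) \<longlonglongrightarrow> z"
      using bounded_imp_convergent_subsequence[OF bdd_Suc] by blast
    then have "F z \<le> (INF k. ereal (Fr k))"
      using LIMSEQ_subseq_LIMSEQ[OF F_lim]
      by (intro lsc_le_lim[OF lscF, where u = "(\<lambda>k. x (Suc k)) \<circ> r" and b = "\<lambda>k. F (x (Suc (r k)))"]) (auto simp: comp_def)
    then have "(INF k. ereal (Fr k)) \<noteq> -\<infinity>"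
      using F_ninf[of z] by auto
    moreover have "(INF k. ereal (Fr k)) \<noteq> \<infinity>"
      using INF_lower[of 0 UNIV "\<lambda>k. ereal (Fr k)"] by auto
    ultimately show thesis
      using that by (cases "INF k. ereal (Fr k)") auto
  qed
  have limF: "(\<lambda>k. F (x k)) \<longlonglongrightarrow> ereal F\<zeta>"
    using F_lim F\<zeta> by (simp add: filterlim_sequentially_Suc[of "\<lambda>k. F (x k)"])
  have cluster_le: "F z \<le> ereal F\<zeta>" if "z \<in> cluster_points x" for z
  proof -
    obtain r where "strict_mono r" "(x \<circ> r) \<longlonglongrightarrow> z"
      using \<open>z \<in> cluster_points x\<close> by (auto simp: cluster_points_def)
    then show ?thesis
      using LIMSEQ_subseq_LIMSEQ[OF limF]
      by (intro lsc_le_lim[OF lscF, where u = "x \<circ> r" and b = "\<lambda>k. F (x (r k))"]) (auto simp: comp_def)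
  qed

  \<comment> \<open>Vanishing steps and criticality of cluster points\<close>
  have "Fr \<longlonglongrightarrow> F\<zeta>"
    using F_lim F\<zeta> by (simp add: Fr)
  \<comment> \<open>As the limit is finite, consecutive differences of the values tend to 0; by
    \<open>Fr_descent\<close> they dominate \<open>c\<close> times the squared steps.\<close>
  then have "(\<lambda>k. (Fr k - Fr (Suc k)) / c) \<longlonglongrightarrow> (F\<zeta> - F\<zeta>) / c"
    by (intro tendsto_intros) (use c_pos in \<open>auto simp: filterlim_sequentially_Suc\<close>)
  then have "(\<lambda>k. (Fr k - Fr (Suc k)) / c) \<longlonglongrightarrow> 0"
    by simp
  then have "(\<lambda>k. (norm (x (Suc (Suc k)) - x (Suc k)))\<^sup>2) \<longlonglongrightarrow> 0"
  proof (rule tendsto_sandwich[OF _ _ tendsto_const, rotated 2])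
    show "\<forall>\<^sub>F k in sequentially. (norm (x (Suc (Suc k)) - x (Suc k)))\<^sup>2 \<le> (Fr k - Fr (Suc k)) / c"
      using Fr_descent c_pos by (intro always_eventually) (simp add: field_simps le_diff_eq add.commute)
  qed simp
  then have "(\<lambda>k. sqrt ((norm (x (Suc k) - x k))\<^sup>2)) \<longlonglongrightarrow> sqrt 0"
    by (intro tendsto_real_sqrt) (simp add: filterlim_sequentially_Suc[of "\<lambda>k. (norm (x (Suc k) - x k))\<^sup>2"])
  then have step_lim: "(\<lambda>k. x (Suc k) - x k) \<longlonglongrightarrow> 0"
    by (simp add: tendsto_norm_zero_iff)

  have cluster_critical: "z \<in> proximal_critical F" if "z \<in> cluster_points x" for z
  proof -
    obtain r where r: "strict_mono r" and lim: "(\<lambda>j. x (r j)) \<longlonglongrightarrow> z"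
      using \<open>z \<in> cluster_points x\<close> by (auto simp: cluster_points_def comp_def)
    have "(\<lambda>j. x (Suc (r j)) - x (r j)) \<longlonglongrightarrow> 0"
      using LIMSEQ_subseq_LIMSEQ[OF step_lim r] by (simp add: comp_def)
    \<comment> \<open>Vanishing steps give the successors of the subsequence the same limit, so both
      centres in \<open>near_minimal\<close> converge to \<open>z\<close>.\<close>
    from tendsto_add[OF this lim] have lim_Suc: "(\<lambda>j. x (Suc (r j))) \<longlonglongrightarrow> z"
      by simp
    \<comment> \<open>Finiteness of \<open>F z\<close> places \<open>z\<close> in both domains.
      Continuity of \<open>df\<close> is known only relative to the domain of \<open>f\<close>, so
      the limit must lie there as well as the iterates.\<close>
    have "F z \<noteq> \<infinity>"
      using cluster_le[OF that] by auto
    then have z: "z \<in> effective_domain f" "z \<in> effective_domain g"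
      by (auto simp: F effective_domain_def)
    have "continuous_on (effective_domain f) df"
      using df(2) by (rule lipschitz_on_continuous_on)
    then have df_lim: "(\<lambda>j. df (x (r j))) \<longlonglongrightarrow> df z"
      by (rule continuous_on_tendsto_compose[OF _ lim z(1)]) (simp add: x_dom_f)
    show ?thesis
      unfolding F using f(3) df(1,2) f_ninf g_ninf z
    proof (rule proximal_criticalI[OF _ _ _ _ _ _ _ C_nonneg])
      fix y
      show "g z \<le> g y + ereal (df z \<bullet> (y - z) + C * (norm (y - z))\<^sup>2)"
      proof (rule lsc_le_lim[OF g(2) lim_Suc])
        show "(\<lambda>j. g y + ereal (df (x (r j)) \<bullet> (y - x (Suc (r j))) + C * (norm (y - x (r j)))\<^sup>2))
            \<longlonglongrightarrow> g y + ereal (df z \<bullet> (y - z) + C * (norm (y - z))\<^sup>2)"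
          \<comment> \<open>Here \<open>g y\<close> may be infinite, so the limit is taken in
            \<open>ereal\<close>; the remaining summand is real.\<close>
          using g_ninf[of y]
          by (intro tendsto_add_ereal_general tendsto_const tendsto_ereal tendsto_intros df_lim lim lim_Suc)
            auto
      qed (use near_minimal in auto)
    qed
  qed

  show ?thesis
    using strict bdd cluster_critical cluster_le limF
      proximal_critical_imp_limiting_critical[OF F_ninf cluster_critical]
    by blast
qed

end
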